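(* Let $(M,g,J)$ be an almost Hermitian manifold, let $(TM,\rho,[\cdot,\cdot]^\rho)$ be a structure of skew-symmetric algebroid on $TM$, and let $\langle\cdot:\cdot\rangle^\rho$ be a symmetric bracket in this algebroid. Define $P^\rho,Q^\rho:\Gamma(TM)\times\Gamma(TM)\to\Gamma(TM)$ by $$P^\rho(X,Y)=-J\big([X,JY]^\rho+[Y,JX]^\rho\big),\qquad Q^\rho(X,Y)=-J\big(\langle X:JY\rangle^\rho+\langle Y:JX\rangle^\rho\big).$$ Then the mapping $\tfrac12(P^\rho+Q^\rho)$ is a symmetric bracket in the skew-symmetric algebroid $(TM,\rho,[\cdot,\cdot]^\rho)$.
   Context: An almost Hermitian manifold $(M,g,J)$ is a $2n$-dimensional Riemannian manifold $(M,g)$ with an orthogonal almost complex structure $J:TM\to TM$. A skew-symmetric algebroid structure $(TM,\rho,[\cdot,\cdot]^\rho)$ consists of a vector bundle homomorphism $\rho:TM\to TM$ over the identity (anchor) and an $\mathbb{R}$-bilinear skew-symmetric map $[\cdot,\cdot]^\rho:\Gamma(TM)\times\Gamma(TM)\to\Gamma(TM)$ with $[X,fY]^\rho=f[X,Y]^\rho+(\rho\circ X)(f)Y$ for $f\in C^\infty(M)$ (no Jacobi identity is assumed). A symmetric bracket in this algebroid is an $\mathbb{R}$-bilinear symmetric map $\langle\cdot:\cdot\rangle:\Gamma(TM)\times\Gamma(TM)\to\Gamma(TM)$ with $\langle X:fY\rangle=f\langle X:Y\rangle+(\rho\circ X)(f)Y$. *)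

theory Defs
  imports "HOL-Analysis.Analysis" "HOL-Library.Function_Algebras"
begin

section \<open>Smooth maps between normed spaces\<close>

text \<open>On an open subset of a Euclidean space this is the usual notion of a C^k map: the map is
  differentiable and all its directional derivatives are of class C^(k-1).\<close>

primrec Ck_on :: "nat \<Rightarrow> 'e set \<Rightarrow> ('e::real_normed_vector \<Rightarrow> 'f::real_normed_vector) \<Rightarrow> bool" where
  "Ck_on 0 S f \<longleftrightarrow> continuous_on S f"
| "Ck_on (Suc k) S f \<longleftrightarrow> (\<forall>x\<in>S. f differentiable (at x)) \<and>
     (\<forall>v. Ck_on k S (\<lambda>x. frechet_derivative f (at x) v))"

definition smooth_on :: "'e set \<Rightarrow> ('e::real_normed_vector \<Rightarrow> 'f::real_normed_vector) \<Rightarrow> bool" where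
  "smooth_on S f \<longleftrightarrow> (\<forall>k. Ck_on k S f)"


section \<open>Smooth manifolds\<close>

text \<open>The manifold is the whole type \<open>'a\<close> (Hausdorff and second countable by its type classes),
  its smooth structure is given by an atlas, not necessarily maximal. A chart is a
  pair \<open>(U, \<phi>)\<close>; the values of \<open>\<phi>\<close> outside \<open>U\<close> are irrelevant.\<close>

type_synonym ('a, 'e) chart = "'a set \<times> ('a \<Rightarrow> 'e)"

definition chart_image :: "('a, 'e) chart \<Rightarrow> 'e set" where
  "chart_image c = snd c ` fst c"

definition chart_inv :: "('a, 'e) chart \<Rightarrow> 'e \<Rightarrow> 'a" where
  "chart_inv c = inv_into (fst c) (snd c)"

definition transition :: "('a, 'e) chart \<Rightarrow> ('a, 'e) chart \<Rightarrow> 'e \<Rightarrow> 'e" where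
  "transition c d = snd d \<circ> chart_inv c"

definition smooth_atlas ::
  "('a::{t2_space, second_countable_topology}, 'e::euclidean_space) chart set \<Rightarrow> bool" where
  "smooth_atlas A \<longleftrightarrow>
     (\<forall>c\<in>A. open (fst c) \<and> open (chart_image c) \<and>
        homeomorphism (fst c) (chart_image c) (snd c) (chart_inv c)) \<and>
     (\<Union>c\<in>A. fst c) = UNIV \<and>
     (\<forall>c\<in>A. \<forall>d\<in>A. smooth_on (snd c ` (fst c \<inter> fst d)) (transition c d))"

definition charts_at :: "('a, 'e) chart set \<Rightarrow> 'a \<Rightarrow> ('a, 'e) chart set" where
  "charts_at A p = {c \<in> A. p \<in> fst c}"

definition smooth_fun :: "('a, 'e::euclidean_space) chart set \<Rightarrow> ('a \<Rightarrow> real) \<Rightarrow> bool" where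
  "smooth_fun A f \<longleftrightarrow> (\<forall>c\<in>A. smooth_on (chart_image c) (f \<circ> chart_inv c))"


section \<open>The tangent bundle\<close>

text \<open>A tangent vector at \<open>p\<close> is the family of its coordinate vectors in all charts around \<open>p\<close>,
  which are related by the derivatives of the transition maps. It vanishes on the other
  charts, so that equality and the vector space operations are those of functions.\<close>

type_synonym ('a, 'e) tvec = "('a, 'e) chart \<Rightarrow> 'e"

definition tangent_space ::
  "('a, 'e::euclidean_space) chart set \<Rightarrow> 'a \<Rightarrow> ('a, 'e) tvec set" where
  "tangent_space A p = {v. (\<forall>c. c \<notin> charts_at A p \<longrightarrow> v c = 0) \<and>
     (\<forall>c\<in>charts_at A p. \<forall>d\<in>charts_at A p.
        v d = frechet_derivative (transition c d) (at (snd c p)) (v c))}"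

definition tscale :: "real \<Rightarrow> ('a, 'e::real_vector) tvec \<Rightarrow> ('a, 'e) tvec" where
  "tscale r v = (\<lambda>c. r *\<^sub>R v c)"

text \<open>The tangent vector at \<open>p\<close> with coordinate vector \<open>e\<close> in the chart \<open>c\<close>. For \<open>e\<close> fixed
  and \<open>p\<close> varying these are the coordinate vector fields of \<open>c\<close>; the coordinate vectors
  in \<open>c\<close> are the local trivialization of the tangent bundle over the domain of \<open>c\<close>.\<close>

definition of_coord ::
  "('a, 'e::euclidean_space) chart set \<Rightarrow> ('a, 'e) chart \<Rightarrow> 'a \<Rightarrow> 'e \<Rightarrow> ('a, 'e) tvec" where
  "of_coord A c p e = (\<lambda>d. if d \<in> charts_at A p
     then frechet_derivative (transition c d) (at (snd c p)) e else 0)"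

text \<open>The derivative of \<open>f\<close> along a tangent vector at \<open>p\<close>. The choice of the chart is
  immaterial, see \<open>tderiv_chart\<close> below.\<close>

definition tderiv ::
  "('a, 'e::euclidean_space) chart set \<Rightarrow> 'a \<Rightarrow> ('a, 'e) tvec \<Rightarrow> ('a \<Rightarrow> real) \<Rightarrow> real" where
  "tderiv A p v f = (let c = (SOME c. c \<in> charts_at A p) in
     frechet_derivative (f \<circ> chart_inv c) (at (snd c p)) (v c))"

type_synonym ('a, 'e) vfield = "'a \<Rightarrow> ('a, 'e) tvec"

definition sections :: "('a, 'e::euclidean_space) chart set \<Rightarrow> ('a, 'e) vfield set" where
  "sections A = {X. (\<forall>p. X p \<in> tangent_space A p) \<and>
     (\<forall>c\<in>A. smooth_on (chart_image c) (\<lambda>x. X (chart_inv c x) c))}"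

definition fscale :: "('a \<Rightarrow> real) \<Rightarrow> ('a, 'e::real_vector) vfield \<Rightarrow> ('a, 'e) vfield" where
  "fscale f X = (\<lambda>p. tscale (f p) (X p))"

text \<open>Smooth bundle maps of the tangent bundle over the identity: fibrewise linear maps whose
  coordinate matrices are smooth in every chart.\<close>

definition bundle_hom ::
  "('a, 'e::euclidean_space) chart set \<Rightarrow> ('a \<Rightarrow> ('a, 'e) tvec \<Rightarrow> ('a, 'e) tvec) \<Rightarrow> bool" where
  "bundle_hom A F \<longleftrightarrow>
     (\<forall>p. \<forall>v\<in>tangent_space A p. F p v \<in> tangent_space A p) \<and>
     (\<forall>p. \<forall>v\<in>tangent_space A p. \<forall>w\<in>tangent_space A p. F p (v + w) = F p v + F p w) \<and>
     (\<forall>p r. \<forall>v\<in>tangent_space A p. F p (tscale r v) = tscale r (F p v)) \<and>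
     (\<forall>c\<in>A. \<forall>e. smooth_on (chart_image c)
        (\<lambda>x. F (chart_inv c x) (of_coord A c (chart_inv c x) e) c))"

definition app_field ::
  "('a \<Rightarrow> ('a, 'e) tvec \<Rightarrow> ('a, 'e) tvec) \<Rightarrow> ('a, 'e) vfield \<Rightarrow> ('a, 'e) vfield" where
  "app_field F X = (\<lambda>p. F p (X p))"

definition field_deriv ::
  "('a, 'e::euclidean_space) chart set \<Rightarrow> ('a, 'e) vfield \<Rightarrow> ('a \<Rightarrow> real) \<Rightarrow> 'a \<Rightarrow> real" where
  "field_deriv A X f = (\<lambda>p. tderiv A p (X p) f)"


section \<open>Almost Hermitian manifolds\<close>

definition riemannian_metric ::
  "('a, 'e::euclidean_space) chart set \<Rightarrow> ('a \<Rightarrow> ('a, 'e) tvec \<Rightarrow> ('a, 'e) tvec \<Rightarrow> real) \<Rightarrow> bool" where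
  "riemannian_metric A g \<longleftrightarrow>
     (\<forall>p. \<forall>u\<in>tangent_space A p. \<forall>v\<in>tangent_space A p. \<forall>w\<in>tangent_space A p.
        g p (u + v) w = g p u w + g p v w) \<and>
     (\<forall>p r. \<forall>v\<in>tangent_space A p. \<forall>w\<in>tangent_space A p. g p (tscale r v) w = r * g p v w) \<and>
     (\<forall>p. \<forall>v\<in>tangent_space A p. \<forall>w\<in>tangent_space A p. g p v w = g p w v) \<and>
     (\<forall>p. \<forall>v\<in>tangent_space A p. v \<noteq> 0 \<longrightarrow> g p v v > 0) \<and>
     (\<forall>c\<in>A. \<forall>e e'. smooth_on (chart_image c)
        (\<lambda>x. g (chart_inv c x) (of_coord A c (chart_inv c x) e) (of_coord A c (chart_inv c x) e')))"

definition almost_complex_structure ::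
  "('a, 'e::euclidean_space) chart set \<Rightarrow> ('a \<Rightarrow> ('a, 'e) tvec \<Rightarrow> ('a, 'e) tvec) \<Rightarrow> bool" where
  "almost_complex_structure A J \<longleftrightarrow> bundle_hom A J \<and>
     (\<forall>p. \<forall>v\<in>tangent_space A p. J p (J p v) = - v)"

definition almost_hermitian ::
  "nat \<Rightarrow> ('a::{t2_space, second_countable_topology}, 'e::euclidean_space) chart set \<Rightarrow>
   ('a \<Rightarrow> ('a, 'e) tvec \<Rightarrow> ('a, 'e) tvec \<Rightarrow> real) \<Rightarrow>
   ('a \<Rightarrow> ('a, 'e) tvec \<Rightarrow> ('a, 'e) tvec) \<Rightarrow> bool" where
  "almost_hermitian n A g J \<longleftrightarrow> DIM('e) = 2 * n \<and> smooth_atlas A \<and>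
     riemannian_metric A g \<and> almost_complex_structure A J \<and>
     (\<forall>p. \<forall>v\<in>tangent_space A p. \<forall>w\<in>tangent_space A p. g p (J p v) (J p w) = g p v w)"


section \<open>Skew-symmetric algebroids and symmetric brackets\<close>

text \<open>Brackets are total functions on arbitrary, not necessarily smooth or tangent, fields; only
  their values on pairs of smooth sections are constrained.\<close>

definition real_bilinear ::
  "('a, 'e::euclidean_space) chart set \<Rightarrow>
   (('a, 'e) vfield \<Rightarrow> ('a, 'e) vfield \<Rightarrow> ('a, 'e) vfield) \<Rightarrow> bool" where
  "real_bilinear A B \<longleftrightarrow>
     (\<forall>X\<in>sections A. \<forall>Y\<in>sections A. B X Y \<in> sections A) \<and>
     (\<forall>X\<in>sections A. \<forall>Y\<in>sections A. \<forall>Z\<in>sections A.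
        B (X + Y) Z = B X Z + B Y Z \<and> B X (Y + Z) = B X Y + B X Z) \<and>
     (\<forall>r. \<forall>X\<in>sections A. \<forall>Y\<in>sections A.
        B (fscale (\<lambda>_. r) X) Y = fscale (\<lambda>_. r) (B X Y) \<and>
        B X (fscale (\<lambda>_. r) Y) = fscale (\<lambda>_. r) (B X Y))"

definition leibniz ::
  "('a, 'e::euclidean_space) chart set \<Rightarrow> ('a \<Rightarrow> ('a, 'e) tvec \<Rightarrow> ('a, 'e) tvec) \<Rightarrow>
   (('a, 'e) vfield \<Rightarrow> ('a, 'e) vfield \<Rightarrow> ('a, 'e) vfield) \<Rightarrow> bool" where
  "leibniz A \<rho> B \<longleftrightarrow>
     (\<forall>X\<in>sections A. \<forall>Y\<in>sections A. \<forall>f. smooth_fun A f \<longrightarrow>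
        B X (fscale f Y) = fscale f (B X Y) + fscale (field_deriv A (app_field \<rho> X) f) Y)"

definition skew_symmetric_algebroid ::
  "('a, 'e::euclidean_space) chart set \<Rightarrow> ('a \<Rightarrow> ('a, 'e) tvec \<Rightarrow> ('a, 'e) tvec) \<Rightarrow>
   (('a, 'e) vfield \<Rightarrow> ('a, 'e) vfield \<Rightarrow> ('a, 'e) vfield) \<Rightarrow> bool" where
  "skew_symmetric_algebroid A \<rho> B \<longleftrightarrow> bundle_hom A \<rho> \<and> real_bilinear A B \<and>
     (\<forall>X\<in>sections A. \<forall>Y\<in>sections A. B X Y = - B Y X) \<and> leibniz A \<rho> B"

definition symmetric_bracket ::
  "('a, 'e::euclidean_space) chart set \<Rightarrow> ('a \<Rightarrow> ('a, 'e) tvec \<Rightarrow> ('a, 'e) tvec) \<Rightarrow>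
   (('a, 'e) vfield \<Rightarrow> ('a, 'e) vfield \<Rightarrow> ('a, 'e) vfield) \<Rightarrow> bool" where
  "symmetric_bracket A \<rho> S \<longleftrightarrow> real_bilinear A S \<and>
     (\<forall>X\<in>sections A. \<forall>Y\<in>sections A. S X Y = S Y X) \<and> leibniz A \<rho> S"


section \<open>Independence of charts\<close>

lemma chart_inv_chart:
  assumes "smooth_atlas A" "c \<in> charts_at A p"
  shows "chart_inv c (snd c p) = p"
proof -
  have "c \<in> A" "p \<in> fst c" using assms(2) by (auto simp: charts_at_def)
  moreover have "homeomorphism (fst c) (chart_image c) (snd c) (chart_inv c)"
    using assms(1) \<open>c \<in> A\<close> unfolding smooth_atlas_def by blast
  ultimately show ?thesis unfolding homeomorphism_def by blast
qed

lemma open_chart_overlap: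
  assumes A: "smooth_atlas A" and c: "c \<in> A" and U: "open U"
  shows "open (snd c ` (fst c \<inter> U))"
proof -
  have h: "homeomorphism (fst c) (chart_image c) (snd c) (chart_inv c)"
    and o: "open (chart_image c)"
    using A c unfolding smooth_atlas_def by blast+
  have "openin (top_of_set (fst c)) (fst c \<inter> U)"
    using U by (auto simp: openin_open)
  from homeomorphism_imp_open_map[OF h this] show ?thesis
    using o openin_open_trans by blast
qed

lemma transition_differentiable:
  assumes A: "smooth_atlas A" and "c \<in> charts_at A p" "d \<in> charts_at A p"
  shows "transition c d differentiable (at (snd c p))"
proof -
  have "smooth_on (snd c ` (fst c \<inter> fst d)) (transition c d)"
    using assms unfolding smooth_atlas_def charts_at_def by blast
  then have "Ck_on (Suc 0) (snd c ` (fst c \<inter> fst d)) (transition c d)"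
    unfolding smooth_on_def by blast
  then show ?thesis using assms(2,3) by (auto simp: charts_at_def)
qed

lemma frechet_derivative_change_chart:
  fixes f :: "'a::{t2_space, second_countable_topology} \<Rightarrow> 'f::real_normed_vector"
  assumes A: "smooth_atlas A" and c: "c \<in> charts_at A p" and d: "d \<in> charts_at A p"
    and f: "(f \<circ> chart_inv d) differentiable (at (snd d p))"
  shows "frechet_derivative (f \<circ> chart_inv c) (at (snd c p)) v =
    frechet_derivative (f \<circ> chart_inv d) (at (snd d p))
      (frechet_derivative (transition c d) (at (snd c p)) v)"
proof -
  let ?S = "snd c ` (fst c \<inter> fst d)"
  have cA: "c \<in> A" and dA: "d \<in> A" using c d by (auto simp: charts_at_def)
  have hc: "homeomorphism (fst c) (chart_image c) (snd c) (chart_inv c)"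
    and hd: "homeomorphism (fst d) (chart_image d) (snd d) (chart_inv d)"
    and od: "open (fst d)"
    using A cA dA unfolding smooth_atlas_def by blast+
  have S: "open ?S" using open_chart_overlap[OF A cA od] .
  have pS: "snd c p \<in> ?S" using c d by (auto simp: charts_at_def)
  have tp: "transition c d (snd c p) = snd d p"
    using chart_inv_chart[OF A c] by (simp add: transition_def)
  have t: "transition c d differentiable (at (snd c p))"
    using transition_differentiable[OF A c d] .
  let ?D = "frechet_derivative (f \<circ> chart_inv d) (at (snd d p)) \<circ>
    frechet_derivative (transition c d) (at (snd c p))"
  have comp: "((f \<circ> chart_inv d) \<circ> transition c d has_derivative ?D) (at (snd c p))"
    using t f unfolding frechet_derivative_works tp[symmetric] by (rule diff_chain_at)
  have eq: "((f \<circ> chart_inv d) \<circ> transition c d) x = (f \<circ> chart_inv c) x" if x: "x \<in> ?S" for x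
  proof -
    obtain q where q: "q \<in> fst c" "q \<in> fst d" "x = snd c q" using x by blast
    have "chart_inv c x = q" "chart_inv d (snd d q) = q"
      using q hc hd unfolding homeomorphism_def by blast+
    then show ?thesis by (simp add: transition_def)
  qed
  have "((f \<circ> chart_inv c) has_derivative ?D) (at (snd c p))"
    by (rule has_derivative_transform_within_open[OF comp S pS eq])
  then have "frechet_derivative (f \<circ> chart_inv c) (at (snd c p)) = ?D"
    by (rule frechet_derivative_at[symmetric])
  then show ?thesis by simp
qed

lemma of_coord_self:
  assumes A: "smooth_atlas A" and c: "c \<in> charts_at A p"
  shows "of_coord A c p e c = e"
proof -
  have cA: "c \<in> A" using c by (auto simp: charts_at_def)
  have hc: "homeomorphism (fst c) (chart_image c) (snd c) (chart_inv c)"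
    and o: "open (chart_image c)"
    using A cA unfolding smooth_atlas_def by blast+
  have p: "snd c p \<in> chart_image c" using c by (auto simp: charts_at_def chart_image_def)
  have "(transition c c has_derivative (\<lambda>x. x)) (at (snd c p))"
    by (rule has_derivative_transform_within_open[OF has_derivative_ident o p])
       (use hc in \<open>simp add: transition_def homeomorphism_def\<close>)
  then have "frechet_derivative (transition c c) (at (snd c p)) = (\<lambda>x. x)"
    by (rule frechet_derivative_at[symmetric])
  then show ?thesis using c by (simp add: of_coord_def)
qed

lemma of_coord_tangent:
  assumes A: "smooth_atlas A" and c: "c \<in> charts_at A p"
  shows "of_coord A c p e \<in> tangent_space A p"
proof -
  have "frechet_derivative (transition c d') (at (snd c p)) e =
      frechet_derivative (transition d d') (at (snd d p))
        (frechet_derivative (transition c d) (at (snd c p)) e)"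
    if d: "d \<in> charts_at A p" and d': "d' \<in> charts_at A p" for d d'
    using frechet_derivative_change_chart[OF A c d, of "snd d'"]
      transition_differentiable[OF A d d'] unfolding transition_def by blast
  note cocycle = this
  show ?thesis unfolding tangent_space_def of_coord_def mem_Collect_eq
    by (intro conjI allI impI ballI; simp only: if_True if_False; rule cocycle)
qed

lemma of_coord_tangent_vector:
  assumes "v \<in> tangent_space A p" "c \<in> charts_at A p"
  shows "of_coord A c p (v c) = v"
proof
  fix d
  have "v d = frechet_derivative (transition c d) (at (snd c p)) (v c)" if "d \<in> charts_at A p"
    using assms that unfolding tangent_space_def by blast
  moreover have "v d = 0" if "d \<notin> charts_at A p"
    using assms that unfolding tangent_space_def by blast
  ultimately show "of_coord A c p (v c) d = v d" by (auto simp: of_coord_def)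
qed

lemma tderiv_chart:
  assumes A: "smooth_atlas A" and c: "c \<in> charts_at A p"
    and v: "v \<in> tangent_space A p" and f: "smooth_fun A f"
  shows "tderiv A p v f = frechet_derivative (f \<circ> chart_inv c) (at (snd c p)) (v c)"
proof -
  define d where "d = (SOME c. c \<in> charts_at A p)"
  have d: "d \<in> charts_at A p" unfolding d_def using c by (rule someI)
  have "smooth_on (chart_image c) (f \<circ> chart_inv c)"
    using f c by (auto simp: smooth_fun_def charts_at_def)
  then have "Ck_on (Suc 0) (chart_image c) (f \<circ> chart_inv c)"
    unfolding smooth_on_def by blast
  then have "(f \<circ> chart_inv c) differentiable (at (snd c p))"
    using c by (auto simp: charts_at_def chart_image_def)
  from frechet_derivative_change_chart[OF A d c this, of "v d"]
  moreover have "v c = frechet_derivative (transition d c) (at (snd d p)) (v d)"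
    using v c d unfolding tangent_space_def by blast
  ultimately show ?thesis by (simp only: tderiv_def Let_def d_def[symmetric])
qed

end

theory Submission
  imports Defs
begin

text \<open>
  Write \<open>D X Y\<close> for half the sum of the two brackets of \<open>X\<close> and \<open>Y\<close>. Both brackets satisfy the
  same Leibniz rule in their second argument, so \<open>D\<close> satisfies it too. Exchanging the arguments
  turns it into a rule for the first argument, in which the two derivative terms come with opposite
  signs, because one bracket is skew and the other one symmetric. They cancel, so \<open>D\<close> is
  \<open>C\<^sup>\<infinity>\<close>-linear in its first argument: it is a connection along the anchor
  (\<open>connection_of_brackets\<close>).

  The map in question is \<open>- J (D X (J Y) + D Y (J X))\<close>, which is visibly symmetric. If \<open>Y\<close> is
  replaced by \<open>f Y\<close>, then the first summand contributes, besides the factor \<open>f\<close>, the term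
  \<open>(\<rho> X)(f) J Y\<close>, and the second one contributes no derivative of \<open>f\<close> at all. Since \<open>J\<close> is
  fibrewise linear and \<open>- J (J Y) = Y\<close>, the Leibniz rule follows
  (\<open>symmetric_bracket_of_connection\<close>).

  For these manipulations the smooth sections must be stable under sums, under multiplication with
  smooth functions, and under \<open>J\<close>. In a chart this comes down to the fact that a bounded bilinear
  product of smooth maps is smooth.
\<close>

section \<open>Calculus of smooth maps\<close>

lemma Ck_on_cong:
  assumes "open S" "\<And>x. x \<in> S \<Longrightarrow> f x = g x" "Ck_on k S f"
  shows "Ck_on k S g"
  using assms
proof (induction k arbitrary: f g)
  case 0
  then show ?case by (simp cong: continuous_on_cong)
next
  case (Suc k)
  have der: "(g has_derivative frechet_derivative f (at x)) (at x)" if "x \<in> S" for x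
  proof (rule has_derivative_transform_within_open[OF _ Suc.prems(1) that])
    show "(f has_derivative frechet_derivative f (at x)) (at x)"
      using Suc.prems(3) that by (simp add: frechet_derivative_works)
  qed (use Suc.prems(2) in auto)
  have eq: "frechet_derivative f (at x) = frechet_derivative g (at x)" if "x \<in> S" for x
    using frechet_derivative_at[OF der[OF that]] .
  have "Ck_on k S (\<lambda>x. frechet_derivative g (at x) v)" for v
    by (rule Suc.IH[OF Suc.prems(1), where f = "\<lambda>x. frechet_derivative f (at x) v"])
      (use eq Suc.prems(3) in auto)
  then show ?case using der by (auto simp: differentiable_def)
qed

lemma Ck_on_SucD: "Ck_on (Suc k) S f \<Longrightarrow> Ck_on k S f"
proof (induction k arbitrary: f)
  case 0
  then show ?case
    by (auto intro!: continuous_at_imp_continuous_on differentiable_imp_continuous_within)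
next
  case (Suc k)
  then show ?case by (simp only: Ck_on.simps) blast
qed

lemma Ck_on_Suc_intro:
  assumes S: "open S" and "\<And>x. x \<in> S \<Longrightarrow> (f has_derivative f' x) (at x)"
    and "\<And>v. Ck_on k S (\<lambda>x. f' x v)"
  shows "Ck_on (Suc k) S f"
proof -
  have "Ck_on k S (\<lambda>x. frechet_derivative f (at x) v)" for v
    by (rule Ck_on_cong[OF S _ assms(3)[of v]]) (use assms(2) frechet_derivative_at in metis)
  then show ?thesis using assms(2) by (auto simp: differentiable_def)
qed

lemma Ck_on_derivative:
  assumes "Ck_on (Suc k) S f" "x \<in> S"
  shows "(f has_derivative frechet_derivative f (at x)) (at x)"
  using assms by (simp add: frechet_derivative_works)

lemma Ck_on_const: "Ck_on k S (\<lambda>x. a)"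
  by (induction k arbitrary: a) simp_all

lemma Ck_on_add:
  assumes "open S" "Ck_on k S f" "Ck_on k S g"
  shows "Ck_on k S (\<lambda>x. f x + g x)"
  using assms(2,3)
proof (induction k arbitrary: f g)
  case 0
  then show ?case by (simp add: continuous_on_add)
next
  case (Suc k)
  show ?case
  proof (rule Ck_on_Suc_intro[OF assms(1)])
    show "((\<lambda>x. f x + g x) has_derivative
        (\<lambda>v. frechet_derivative f (at x) v + frechet_derivative g (at x) v)) (at x)"
      if "x \<in> S" for x
      by (intro has_derivative_add Ck_on_derivative[OF Suc.prems(1) that]
          Ck_on_derivative[OF Suc.prems(2) that])
  qed (use Suc in auto)
qed

text \<open>Induction on the class: by the product rule the derivative is a sum of products of one factor
  with the derivative of the other, and the undifferentiated factor may be regarded as a map of the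
  lower class.\<close>

lemma Ck_on_bilinear:
  assumes S: "open S" and b: "bounded_bilinear b"
    and "Ck_on k S f" "Ck_on k S g"
  shows "Ck_on k S (\<lambda>x. b (f x) (g x))"
  using assms(3,4)
proof (induction k arbitrary: f g)
  case 0
  then show ?case by (simp add: bounded_bilinear.continuous_on[OF b])
next
  case (Suc k)
  show ?case
  proof (rule Ck_on_Suc_intro[OF S])
    show "((\<lambda>x. b (f x) (g x)) has_derivative
        (\<lambda>v. b (f x) (frechet_derivative g (at x) v) + b (frechet_derivative f (at x) v) (g x))) (at x)"
      if "x \<in> S" for x
      by (intro bounded_bilinear.FDERIV[OF b] Ck_on_derivative[OF Suc.prems(1) that]
          Ck_on_derivative[OF Suc.prems(2) that])
    show "Ck_on k S (\<lambda>x. b (f x) (frechet_derivative g (at x) v)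
        + b (frechet_derivative f (at x) v) (g x))" for v
      by (rule Ck_on_add[OF S]; rule Suc.IH)
        (use Suc.prems Suc.prems[THEN Ck_on_SucD] in simp_all)
  qed
qed

lemma smooth_on_cong:
  assumes "open S" "\<And>x. x \<in> S \<Longrightarrow> f x = g x" "smooth_on S f"
  shows "smooth_on S g"
  unfolding smooth_on_def
proof
  show "Ck_on k S g" for k
    using Ck_on_cong[OF assms(1,2)] assms(3) by (simp add: smooth_on_def)
qed

lemma smooth_on_const: "smooth_on S (\<lambda>x. a)"
  by (simp add: smooth_on_def Ck_on_const)

lemma smooth_on_add:
  assumes "open S" "smooth_on S f" "smooth_on S g"
  shows "smooth_on S (\<lambda>x. f x + g x)"
  using assms by (simp add: smooth_on_def Ck_on_add)

lemma smooth_on_bilinear: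
  assumes "open S" "bounded_bilinear b" "smooth_on S f" "smooth_on S g"
  shows "smooth_on S (\<lambda>x. b (f x) (g x))"
  using assms by (simp add: smooth_on_def Ck_on_bilinear)

lemma smooth_on_sum:
  assumes "open S" "finite I" "\<And>i. i \<in> I \<Longrightarrow> smooth_on S (f i)"
  shows "smooth_on S (\<lambda>x. \<Sum>i\<in>I. f i x)"
  using assms(2,3)
  by (induction I rule: finite_induct) (auto simp: smooth_on_const smooth_on_add[OF assms(1)])

section \<open>Tangent spaces and bundle maps\<close>

lemma atlas_chart_image:
  assumes "smooth_atlas A" "c \<in> A"
  shows "open (chart_image c)"
    and "x \<in> chart_image c \<Longrightarrow> c \<in> charts_at A (chart_inv c x)"
proof -
  have h: "homeomorphism (fst c) (chart_image c) (snd c) (chart_inv c)"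
    and o: "open (chart_image c)"
    using assms unfolding smooth_atlas_def by blast+
  show "open (chart_image c)" by (rule o)
  show "c \<in> charts_at A (chart_inv c x)" if "x \<in> chart_image c"
    using homeomorphism_image2[OF h] that assms(2) unfolding charts_at_def by blast
qed

lemma transition_derivative_linear:
  assumes "smooth_atlas A" "c \<in> charts_at A p" "d \<in> charts_at A p"
  shows "linear (frechet_derivative (transition c d) (at (snd c p)))"
  using transition_differentiable[OF assms] by (rule linear_frechet_derivative)

text \<open>The compatibility condition is oriented so that it can serve as a rewrite rule; the opposite
  orientation leads from one chart to the other and back forever.\<close>

lemma tangent_space_iff:
  "v \<in> tangent_space A p \<longleftrightarrow> (\<forall>c. c \<notin> charts_at A p \<longrightarrow> v c = 0) \<and>
     (\<forall>c\<in>charts_at A p. \<forall>d\<in>charts_at A p.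
        frechet_derivative (transition c d) (at (snd c p)) (v c) = v d)"
  unfolding tangent_space_def mem_Collect_eq eq_commute[of "frechet_derivative _ _ _"] ..

lemma tangent_space_add:
  assumes "smooth_atlas A" "v \<in> tangent_space A p" "w \<in> tangent_space A p"
  shows "v + w \<in> tangent_space A p"
  using assms(2,3) linear_add[OF transition_derivative_linear[OF assms(1)]]
  by (simp add: tangent_space_iff)

lemma tangent_space_scale:
  assumes "smooth_atlas A" "v \<in> tangent_space A p"
  shows "tscale r v \<in> tangent_space A p"
  using assms(2) linear_scale[OF transition_derivative_linear[OF assms(1)]]
  by (simp add: tangent_space_iff tscale_def)

lemma of_coord_add:
  assumes "smooth_atlas A" "c \<in> charts_at A p"
  shows "of_coord A c p (e + e') = of_coord A c p e + of_coord A c p e'"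
  using linear_add[OF transition_derivative_linear[OF assms]]
  by (auto simp: of_coord_def)

lemma of_coord_scale:
  assumes "smooth_atlas A" "c \<in> charts_at A p"
  shows "of_coord A c p (r *\<^sub>R e) = tscale r (of_coord A c p e)"
  using linear_scale[OF transition_derivative_linear[OF assms]]
  by (auto simp: of_coord_def tscale_def)

lemma bundle_hom_coordinates_linear:
  assumes A: "smooth_atlas A" and F: "bundle_hom A F" and c: "c \<in> charts_at A p"
  shows "linear (\<lambda>e. F p (of_coord A c p e) c)"
proof (rule linearI)
  show "F p (of_coord A c p (e + e')) c = F p (of_coord A c p e) c + F p (of_coord A c p e') c"
    for e e'
    using F of_coord_tangent[OF A c] by (simp add: of_coord_add[OF A c] bundle_hom_def)
  show "F p (of_coord A c p (r *\<^sub>R e)) c = r *\<^sub>R F p (of_coord A c p e) c" for r e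
  proof -
    have "F p (tscale r (of_coord A c p e)) = tscale r (F p (of_coord A c p e))"
      using F of_coord_tangent[OF A c] by (simp add: bundle_hom_def)
    then show ?thesis by (simp add: of_coord_scale[OF A c] tscale_def)
  qed
qed

lemma bundle_hom_coordinates:
  fixes A :: "('a::{t2_space, second_countable_topology}, 'e::euclidean_space) chart set"
  assumes A: "smooth_atlas A" and F: "bundle_hom A F" and c: "c \<in> charts_at A p"
    and v: "v \<in> tangent_space A p"
  shows "F p v c = (\<Sum>b\<in>Basis. (v c \<bullet> b) *\<^sub>R F p (of_coord A c p b) c)"
proof -
  interpret linear "\<lambda>e. F p (of_coord A c p e) c"
    using bundle_hom_coordinates_linear[OF A F c] .
  have "F p v c = F p (of_coord A c p (\<Sum>b\<in>Basis. (v c \<bullet> b) *\<^sub>R b)) c"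
    by (simp add: euclidean_representation of_coord_tangent_vector[OF v c])
  also have "\<dots> = (\<Sum>b\<in>Basis. (v c \<bullet> b) *\<^sub>R F p (of_coord A c p b) c)"
    by (simp add: sum scale)
  finally show ?thesis .
qed

section \<open>Smooth sections\<close>

lemma sections_tangent: "X \<in> sections A \<Longrightarrow> X p \<in> tangent_space A p"
  by (simp add: sections_def)

lemma sections_smooth:
  "X \<in> sections A \<Longrightarrow> c \<in> A \<Longrightarrow> smooth_on (chart_image c) (\<lambda>x. X (chart_inv c x) c)"
  by (simp add: sections_def)

lemma smooth_fun_const: "smooth_fun A (\<lambda>_. r)"
  by (simp add: smooth_fun_def comp_def smooth_on_const)

lemma sections_add:
  assumes "smooth_atlas A" "X \<in> sections A" "Y \<in> sections A"
  shows "X + Y \<in> sections A"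
  using assms by (auto simp: sections_def tangent_space_add
      intro!: smooth_on_add atlas_chart_image)

lemma sections_fscale:
  assumes A: "smooth_atlas A" and f: "smooth_fun A f" and X: "X \<in> sections A"
  shows "fscale f X \<in> sections A"
  unfolding sections_def mem_Collect_eq
proof (intro conjI allI ballI)
  show "fscale f X p \<in> tangent_space A p" for p
    using X by (simp add: fscale_def sections_tangent tangent_space_scale[OF A])
  show "smooth_on (chart_image c) (\<lambda>x. fscale f X (chart_inv c x) c)" if c: "c \<in> A" for c
    using smooth_on_bilinear[OF atlas_chart_image(1)[OF A c] bounded_bilinear_scaleR _
        sections_smooth[OF X c], of "f \<circ> chart_inv c"] f c
    by (simp add: fscale_def tscale_def smooth_fun_def)
qed

lemma sections_uminus:
  assumes "smooth_atlas A" "X \<in> sections A"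
  shows "- X \<in> sections A"
proof -
  have "fscale (\<lambda>_. -1) X = - X"
    by (simp add: fun_eq_iff fscale_def tscale_def)
  then show ?thesis using sections_fscale[OF assms(1) smooth_fun_const assms(2)] by metis
qed

text \<open>In a chart, the coordinates of the image are sums of products of the coordinates of the field
  with the smooth matrix entries of the bundle map.\<close>

lemma sections_app_field:
  assumes A: "smooth_atlas A" and F: "bundle_hom A F" and X: "X \<in> sections A"
  shows "app_field F X \<in> sections A"
  unfolding sections_def mem_Collect_eq
proof (intro conjI allI ballI)
  show "app_field F X p \<in> tangent_space A p" for p
    using F sections_tangent[OF X] by (simp add: app_field_def bundle_hom_def)
  show "smooth_on (chart_image c) (\<lambda>x. app_field F X (chart_inv c x) c)" if c: "c \<in> A" for c
  proof (rule smooth_on_cong)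
    show o: "open (chart_image c)" by (rule atlas_chart_image(1)[OF A c])
    have "smooth_on (chart_image c) (\<lambda>x. F (chart_inv c x) (of_coord A c (chart_inv c x) b) c)" for b
      using F c by (simp add: bundle_hom_def)
    then show "smooth_on (chart_image c) (\<lambda>x. \<Sum>b\<in>Basis. (X (chart_inv c x) c \<bullet> b) *\<^sub>R
        F (chart_inv c x) (of_coord A c (chart_inv c x) b) c)"
      by (intro smooth_on_sum[OF o] finite_Basis
          smooth_on_bilinear[OF o bounded_bilinear_scaleR]
          smooth_on_bilinear[OF o bounded_bilinear_inner]
          sections_smooth[OF X c] smooth_on_const)
    show "(\<Sum>b\<in>Basis. (X (chart_inv c x) c \<bullet> b) *\<^sub>R
        F (chart_inv c x) (of_coord A c (chart_inv c x) b) c) = app_field F X (chart_inv c x) c"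
      if "x \<in> chart_image c" for x
      using bundle_hom_coordinates[OF A F atlas_chart_image(2)[OF A c that] sections_tangent[OF X]]
      by (simp add: app_field_def)
  qed
qed

lemma fscale_simps:
  shows "fscale f (X + Y) = fscale f X + fscale f Y"
    and "fscale f (- X) = - fscale f X"
    and "fscale f (fscale g X) = fscale (\<lambda>p. f p * g p) X"
    and "fscale f (X - Y) = fscale f X - fscale f Y"
  by (simp_all add: fun_eq_iff fscale_def tscale_def algebra_simps)

lemma fscale_commute: "fscale f (fscale g X) = fscale g (fscale f X)"
  by (simp add: fscale_simps mult.commute)

text \<open>Stated for all tangent fields and all functions, so that it applies directly to the multiples
  of a field by the derivative of a function in the Leibniz rule.\<close>

lemma
  assumes F: "bundle_hom A F" and X: "\<And>p. X p \<in> tangent_space A p"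
  shows app_field_add: "(\<And>p. Y p \<in> tangent_space A p) \<Longrightarrow>
      app_field F (X + Y) = app_field F X + app_field F Y"
    and app_field_fscale: "app_field F (fscale f X) = fscale f (app_field F X)"
  using F X unfolding bundle_hom_def
  by (simp_all add: app_field_def fscale_def fun_eq_iff)

section \<open>Connections along the anchor\<close>

definition algebroid_connection ::
  "('a, 'e::euclidean_space) chart set \<Rightarrow> ('a \<Rightarrow> ('a, 'e) tvec \<Rightarrow> ('a, 'e) tvec) \<Rightarrow>
   (('a, 'e) vfield \<Rightarrow> ('a, 'e) vfield \<Rightarrow> ('a, 'e) vfield) \<Rightarrow> bool" where
  "algebroid_connection A \<rho> D \<longleftrightarrow> real_bilinear A D \<and> leibniz A \<rho> D \<and>
     (\<forall>X\<in>sections A. \<forall>Y\<in>sections A. \<forall>f. smooth_fun A f \<longrightarrow>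
        D (fscale f X) Y = fscale f (D X Y))"

text \<open>In the first argument the skew bracket contributes \<open>- (\<rho> Y)(f) X\<close> and the symmetric one
  \<open>(\<rho> Y)(f) X\<close>. The factor one half normalizes the Leibniz rule in the second argument, where
  the two contributions agree.\<close>

lemma connection_of_brackets:
  fixes A :: "('a::{t2_space, second_countable_topology}, 'e::euclidean_space) chart set"
  assumes A: "smooth_atlas A" and br: "skew_symmetric_algebroid A \<rho> br"
    and sb: "symmetric_bracket A \<rho> sb"
  shows "algebroid_connection A \<rho> (\<lambda>X Y. fscale (\<lambda>_. 1 / 2) (br X Y + sb X Y))"
proof -
  have bil: "real_bilinear A br" "real_bilinear A sb"
    and leib: "leibniz A \<rho> br" "leibniz A \<rho> sb"
    and skew: "\<And>X Y. X \<in> sections A \<Longrightarrow> Y \<in> sections A \<Longrightarrow> br X Y = - br Y X"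
    and sym: "\<And>X Y. X \<in> sections A \<Longrightarrow> Y \<in> sections A \<Longrightarrow> sb X Y = sb Y X"
    using br sb unfolding skew_symmetric_algebroid_def symmetric_bracket_def by blast+
  have half: "fscale (\<lambda>_. 1 / 2) (Z + Z) = Z" for Z :: "('a, 'e) vfield"
    by (simp add: fun_eq_iff fscale_def tscale_def flip: scaleR_2)
  show ?thesis
    unfolding algebroid_connection_def
  proof (intro conjI ballI allI impI)
    show "real_bilinear A (\<lambda>X Y. fscale (\<lambda>_. 1 / 2) (br X Y + sb X Y))"
      unfolding real_bilinear_def
    proof (intro conjI ballI allI)
      let ?D = "\<lambda>X Y. fscale (\<lambda>_. 1 / 2) (br X Y + sb X Y)"
      fix X Y :: "('a, 'e) vfield" and r :: real
      assume X: "X \<in> sections A" and Y: "Y \<in> sections A"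
      have "br X Y \<in> sections A" "sb X Y \<in> sections A"
        using bil X Y unfolding real_bilinear_def by blast+
      then show "?D X Y \<in> sections A"
        by (intro sections_fscale[OF A smooth_fun_const] sections_add[OF A])
      show "?D (X + Y) Z = ?D X Z + ?D Y Z" "?D X (Y + Z) = ?D X Y + ?D X Z"
        if Z: "Z \<in> sections A" for Z
        using bil X Y Z unfolding real_bilinear_def by (simp_all add: fscale_simps add_ac)
      show "?D (fscale (\<lambda>_. r) X) Y = fscale (\<lambda>_. r) (?D X Y)"
        "?D X (fscale (\<lambda>_. r) Y) = fscale (\<lambda>_. r) (?D X Y)"
        using bil X Y unfolding real_bilinear_def by (simp_all add: fscale_simps mult.commute)
    qed
  next
    show "leibniz A \<rho> (\<lambda>X Y. fscale (\<lambda>_. 1 / 2) (br X Y + sb X Y))"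
      unfolding leibniz_def
    proof (intro ballI allI impI)
      fix X Y f
      assume X: "X \<in> sections A" and Y: "Y \<in> sections A" and f: "smooth_fun A f"
      let ?Z = "fscale (field_deriv A (app_field \<rho> X) f) Y"
      have "br X (fscale f Y) + sb X (fscale f Y) = fscale f (br X Y + sb X Y) + (?Z + ?Z)"
        using leib X Y f unfolding leibniz_def by (simp add: fscale_simps add_ac)
      then show "fscale (\<lambda>_. 1 / 2) (br X (fscale f Y) + sb X (fscale f Y)) =
          fscale f (fscale (\<lambda>_. 1 / 2) (br X Y + sb X Y)) + ?Z"
        by (simp only: fscale_simps(1)[of _ "fscale f _"] half fscale_commute[of f])
    qed
  next
    fix X Y f
    assume X: "X \<in> sections A" and Y: "Y \<in> sections A" and f: "smooth_fun A f"
    let ?Z = "fscale (field_deriv A (app_field \<rho> Y) f) X"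
    have fX: "fscale f X \<in> sections A" by (rule sections_fscale[OF A f X])
    have "br Y (fscale f X) = fscale f (br Y X) + ?Z" "sb Y (fscale f X) = fscale f (sb Y X) + ?Z"
      using leib X Y f unfolding leibniz_def by blast+
    then have "br (fscale f X) Y + sb (fscale f X) Y = fscale f (br X Y + sb X Y)"
      by (simp add: skew[OF fX Y] sym[OF fX Y] skew[OF X Y] sym[OF X Y] fscale_simps)
    then show "fscale (\<lambda>_. 1 / 2) (br (fscale f X) Y + sb (fscale f X) Y) =
        fscale f (fscale (\<lambda>_. 1 / 2) (br X Y + sb X Y))"
      by (simp only: fscale_commute[of f])
  qed
qed

text \<open>Only the first of the two summands differentiates \<open>f\<close> when \<open>Y\<close> is replaced by \<open>f Y\<close>, and
  \<open>- J\<close> undoes the \<open>J\<close> on the resulting multiple of \<open>J Y\<close>.\<close>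

lemma symmetric_bracket_of_connection:
  fixes A :: "('a::{t2_space, second_countable_topology}, 'e::euclidean_space) chart set"
  assumes A: "smooth_atlas A" and J: "almost_complex_structure A J"
    and D: "algebroid_connection A \<rho> D"
  shows "symmetric_bracket A \<rho>
    (\<lambda>X Y. - app_field J (D X (app_field J Y) + D Y (app_field J X)))"
    (is "symmetric_bracket A \<rho> ?S")
proof -
  have hom: "bundle_hom A J"
    and JJ: "\<And>p v. v \<in> tangent_space A p \<Longrightarrow> J p (J p v) = - v"
    using J by (auto simp: almost_complex_structure_def)
  have bil: "real_bilinear A D" and leib: "leibniz A \<rho> D"
    and tens: "\<And>X Y f. X \<in> sections A \<Longrightarrow> Y \<in> sections A \<Longrightarrow> smooth_fun A f \<Longrightarrow>
      D (fscale f X) Y = fscale f (D X Y)"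
    using D by (auto simp: algebroid_connection_def)
  note Jsec = sections_app_field[OF A hom]
  note sec = sections_add[OF A] sections_fscale[OF A] sections_uminus[OF A] Jsec
  note tan = sections_tangent
  have Dsec: "D X Y \<in> sections A" if "X \<in> sections A" "Y \<in> sections A" for X Y
    using bil that by (simp add: real_bilinear_def)
  have D_add: "D (X + Y) Z = D X Z + D Y Z" "D Z (X + Y) = D Z X + D Z Y"
    if "X \<in> sections A" "Y \<in> sections A" "Z \<in> sections A" for X Y Z
    using bil that by (simp_all add: real_bilinear_def)
  have D_scale: "D X (fscale (\<lambda>_. r) Y) = fscale (\<lambda>_. r) (D X Y)"
    if "X \<in> sections A" "Y \<in> sections A" for r X Y
    using bil that by (simp add: real_bilinear_def)
  have J_add: "app_field J (X + Y) = app_field J X + app_field J Y"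
    if "X \<in> sections A" "Y \<in> sections A" for X Y
    using that by (intro app_field_add[OF hom] tan)
  have J_scale: "app_field J (fscale f X) = fscale f (app_field J X)"
    if "X \<in> sections A" for f X
    using that by (intro app_field_fscale[OF hom] tan)
  have sym: "?S X Y = ?S Y X" for X Y
    by (simp add: add.commute)
  have add: "?S (X + Y) Z = ?S X Z + ?S Y Z"
    if "X \<in> sections A" "Y \<in> sections A" "Z \<in> sections A" for X Y Z
    using that by (simp add: J_add D_add Dsec sec add_ac)
  have scale: "?S (fscale (\<lambda>_. r) X) Y = fscale (\<lambda>_. r) (?S X Y)"
    if "X \<in> sections A" "Y \<in> sections A" for r X Y
    using that by (simp add: J_scale J_add tens D_scale Dsec sec smooth_fun_const fscale_simps)
  have leibS: "?S X (fscale f Y) = fscale f (?S X Y) + fscale (field_deriv A (app_field \<rho> X) f) Y"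
    if X: "X \<in> sections A" and Y: "Y \<in> sections A" and f: "smooth_fun A f" for X Y f
  proof -
    let ?h = "field_deriv A (app_field \<rho> X) f"
    let ?W = "D X (app_field J Y) + D Y (app_field J X)"
    have W: "?W \<in> sections A" using X Y by (intro sec Dsec)
    have "D X (app_field J (fscale f Y)) = fscale f (D X (app_field J Y)) + fscale ?h (app_field J Y)"
      using leib X Jsec[OF Y] f by (simp add: J_scale[OF Y] leibniz_def)
    then have "D X (app_field J (fscale f Y)) + D (fscale f Y) (app_field J X) =
        fscale f ?W + fscale ?h (app_field J Y)"
      by (simp add: tens[OF Y Jsec[OF X] f] fscale_simps add_ac)
    moreover have "app_field J (fscale f ?W + fscale ?h (app_field J Y)) =
        app_field J (fscale f ?W) + app_field J (fscale ?h (app_field J Y))"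
    proof (rule app_field_add[OF hom])
      show "fscale f ?W p \<in> tangent_space A p" for p
        by (rule tan[OF sections_fscale[OF A f W]])
      show "fscale ?h (app_field J Y) p \<in> tangent_space A p" for p
        using tan[OF Jsec[OF Y]] by (simp add: fscale_def tangent_space_scale[OF A])
    qed
    moreover have "app_field J (app_field J Y) = - Y"
      by (simp add: app_field_def fun_eq_iff JJ[OF tan[OF Y]])
    ultimately show ?thesis
      by (simp add: J_scale[OF W] J_scale[OF Jsec[OF Y]] fscale_simps(2))
  qed
  have "real_bilinear A ?S"
    unfolding real_bilinear_def
  proof (intro conjI ballI allI)
    show "?S X Y \<in> sections A" if "X \<in> sections A" "Y \<in> sections A" for X Y
      using that by (intro sec Dsec)
    show "?S (X + Y) Z = ?S X Z + ?S Y Z" "?S X (Y + Z) = ?S X Y + ?S X Z"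
      if "X \<in> sections A" "Y \<in> sections A" "Z \<in> sections A" for X Y Z
      using add that sym by metis+
    show "?S (fscale (\<lambda>_. r) X) Y = fscale (\<lambda>_. r) (?S X Y)"
      "?S X (fscale (\<lambda>_. r) Y) = fscale (\<lambda>_. r) (?S X Y)"
      if "X \<in> sections A" "Y \<in> sections A" for r X Y
      using scale that sym by metis+
  qed
  then show ?thesis
    unfolding symmetric_bracket_def leibniz_def using sym leibS by blast
qed

lemma symmetric_bracket_cong:
  assumes A: "smooth_atlas A" and S: "symmetric_bracket A \<rho> S"
    and eq: "\<And>X Y. X \<in> sections A \<Longrightarrow> Y \<in> sections A \<Longrightarrow> T X Y = S X Y"
  shows "symmetric_bracket A \<rho> T"
  using S unfolding symmetric_bracket_def real_bilinear_def leibniz_def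
  by (simp add: eq sections_add[OF A] sections_fscale[OF A] smooth_fun_const)

theorem theorem6p3:
  fixes n :: nat
    and A :: "('a::{t2_space, second_countable_topology}, 'e::euclidean_space) chart set"
    and g :: "'a \<Rightarrow> ('a, 'e) tvec \<Rightarrow> ('a, 'e) tvec \<Rightarrow> real"
    and J \<rho> :: "'a \<Rightarrow> ('a, 'e) tvec \<Rightarrow> ('a, 'e) tvec"
    and br sb P Q :: "('a, 'e) vfield \<Rightarrow> ('a, 'e) vfield \<Rightarrow> ('a, 'e) vfield"
  assumes "almost_hermitian n A g J"
    and "skew_symmetric_algebroid A \<rho> br"
    and "symmetric_bracket A \<rho> sb"
    and "\<And>X Y. X \<in> sections A \<Longrightarrow> Y \<in> sections A \<Longrightarrow>
           P X Y = - app_field J (br X (app_field J Y) + br Y (app_field J X))"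
    and "\<And>X Y. X \<in> sections A \<Longrightarrow> Y \<in> sections A \<Longrightarrow>
           Q X Y = - app_field J (sb X (app_field J Y) + sb Y (app_field J X))"
  shows "symmetric_bracket A \<rho> (\<lambda>X Y. fscale (\<lambda>_. 1 / 2) (P X Y + Q X Y))"
proof (rule symmetric_bracket_cong)
  \<comment> \<open>The two maps agree on smooth sections only; elsewhere \<open>P\<close> and \<open>Q\<close> are arbitrary.\<close>
  show A: "smooth_atlas A" using assms(1) by (simp add: almost_hermitian_def)
  have J: "almost_complex_structure A J" using assms(1) by (simp add: almost_hermitian_def)
  then have hom: "bundle_hom A J" by (simp add: almost_complex_structure_def)
  let ?D = "\<lambda>X Y. fscale (\<lambda>_. 1 / 2) (br X Y + sb X Y)"
  let ?S = "\<lambda>X Y. - app_field J (?D X (app_field J Y) + ?D Y (app_field J X))"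
  show "symmetric_bracket A \<rho> ?S"
    by (rule symmetric_bracket_of_connection[OF A J connection_of_brackets[OF A assms(2,3)]])
  fix X Y assume X: "X \<in> sections A" and Y: "Y \<in> sections A"
  note JX = sections_app_field[OF A hom X] and JY = sections_app_field[OF A hom Y]
  have br: "br U V \<in> sections A" and sb: "sb U V \<in> sections A"
    if "U \<in> sections A" "V \<in> sections A" for U V
    using assms(2,3) that
    unfolding skew_symmetric_algebroid_def symmetric_bracket_def real_bilinear_def by blast+
  let ?p = "br X (app_field J Y) + br Y (app_field J X)"
  let ?q = "sb X (app_field J Y) + sb Y (app_field J X)"
  have p: "?p \<in> sections A" and q: "?q \<in> sections A"
    by (simp_all add: sections_add[OF A] br sb X Y JX JY)
  have "?D X (app_field J Y) + ?D Y (app_field J X) = fscale (\<lambda>_. 1 / 2) (?p + ?q)"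
    by (simp add: fscale_simps add_ac)
  then have "?S X Y = - fscale (\<lambda>_. 1 / 2) (app_field J (?p + ?q))"
    by (simp only: app_field_fscale[OF hom sections_tangent[OF sections_add[OF A p q]]])
  also have "app_field J (?p + ?q) = app_field J ?p + app_field J ?q"
    by (rule app_field_add[OF hom sections_tangent[OF p] sections_tangent[OF q]])
  finally have "?S X Y = fscale (\<lambda>_. 1 / 2) (- (app_field J ?p + app_field J ?q))"
    by (simp only: fscale_simps(2))
  also have "- (app_field J ?p + app_field J ?q) = P X Y + Q X Y"
    by (simp add: assms(4,5)[OF X Y])
  finally show "fscale (\<lambda>_. 1 / 2) (P X Y + Q X Y) = ?S X Y" by (rule sym)
qed

end
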